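(* Let $(\mathcal Q,d)$ be a separable and complete metric space and let $o\in\mathcal Q$ be an arbitrary fixed element. Let $Y$ be a random variable with values in $\mathcal Q$, and let $Y_1,Y_2,\dots$ be independent random variables with the same distribution as $Y$. Let $h\colon[0,\infty)\to[0,\infty)$ be a non-decreasing function and define $H\colon[0,\infty)\to[0,\infty)$, $H(x)=\int_0^x h(t)\,\mathrm dt$. Let $(\epsilon_n)_{n\in\mathbb N}\subseteq[0,\infty)$ with $\epsilon_n\to0$ as $n\to\infty$. Set $$M=\operatorname*{arg\,min}_{q\in\mathcal Q}\mathbb E[H(d(Y,q))-H(d(Y,o))],\qquad M_n=\epsilon_n\text{-}\operatorname*{arg\,min}_{q\in\mathcal Q}\frac1n\sum_{i=1}^n\bigl(H(d(Y_i,q))-H(d(Y_i,o))\bigr).$$ Assume that there is $b\in[1,\infty)$ such that $h(2x)\le b\,h(x)$ for all $x\ge0$, and that $\mathbb E[h(d(Y,o))]<\infty$. Then, almost surely, $$\operatorname*{lim\,\overline{sup}}_{n\to\infty}M_n\subseteq M.$$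
   Context: All random variables are defined on a common probability space $(\Omega,\Sigma,\mathbb P)$; $\mathcal Q$ carries its Borel $\sigma$-algebra. For $f\colon\mathcal Q\to\mathbb R$ and $\epsilon\ge0$: $\operatorname{arg\,min} f=\{q\in\mathcal Q: f(q)=\inf_{\mathcal Q} f\}$ and $\epsilon\text{-}\operatorname{arg\,min} f=\{q\in\mathcal Q: f(q)\le\epsilon+\inf_{\mathcal Q} f\}$ (empty if $\inf_{\mathcal Q} f=-\infty$). The outer limit of a sequence of sets $B_n\subseteq\mathcal Q$ is $\operatorname*{lim\,\overline{sup}}_{n\to\infty}B_n:=\bigcap_{n\in\mathbb N}\overline{\bigcup_{k\ge n}B_k}$, where the bar denotes topological closure in $\mathcal Q$. "Almost surely" means outside a set contained in a $\mathbb P$-null set. *)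

theory Defs
  imports "HOL-Probability.Probability"
begin

text \<open>
  The infima below are taken in the extended reals: for a function unbounded below the infimum
  is minus infinity and the sets are empty, whereas the conditionally complete \<^const>\<open>Inf\<close>
  on the reals would return an unspecified value.
\<close>

definition argmin_set :: "('a \<Rightarrow> real) \<Rightarrow> 'a set" where
  "argmin_set f = {q. ereal (f q) = (INF p. ereal (f p))}"

definition eps_argmin_set :: "real \<Rightarrow> ('a \<Rightarrow> real) \<Rightarrow> 'a set" where
  "eps_argmin_set \<epsilon> f = {q. ereal (f q) \<le> ereal \<epsilon> + (INF p. ereal (f p))}"

text \<open>Sequences are indexed by the positive integers; the value at 0 is ignored.\<close>

definition outer_limit :: "(nat \<Rightarrow> 'a::topological_space set) \<Rightarrow> 'a set" where
  "outer_limit B = (\<Inter>n\<in>{1..}. closure (\<Union>k\<in>{n..}. B k))"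

text \<open>Only the values of \<open>h\<close> on the nonnegative reals matter, for arguments \<open>x \<ge> 0\<close>.\<close>

definition primitive :: "(real \<Rightarrow> real) \<Rightarrow> real \<Rightarrow> real" where
  "primitive h x = (LBINT t:{0..x}. h t)"

definition population_objective ::
    "'w measure \<Rightarrow> (real \<Rightarrow> real) \<Rightarrow> ('w \<Rightarrow> 'a::metric_space) \<Rightarrow> 'a \<Rightarrow> 'a \<Rightarrow> real" where
  "population_objective P H Y q0 q = (\<integral>\<omega>. H (dist (Y \<omega>) q) - H (dist (Y \<omega>) q0) \<partial>P)"

definition empirical_objective ::
    "(real \<Rightarrow> real) \<Rightarrow> (nat \<Rightarrow> 'a::metric_space) \<Rightarrow> 'a \<Rightarrow> nat \<Rightarrow> 'a \<Rightarrow> real" where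
  "empirical_objective H y q0 n q =
     1 / real n * (\<Sum>i=1..n. H (dist (y i) q) - H (dist (y i) q0))"

end

theory Submission
  imports Defs
begin

text \<open>
  Write \<open>F\<close> for the population objective and \<open>G n\<close> for the empirical ones. The theorem is a
  pointwise law of large numbers made locally uniform by equicontinuity.

  A monotone rate \<open>h\<close> makes \<open>q \<mapsto> H (d(y, q))\<close>, with \<open>H\<close> the primitive of \<open>h\<close>, Lipschitz on a ball of
  radius \<open>D\<close> around \<open>q0\<close> with constant \<open>h (d(y, q0) + D)\<close>, and the doubling condition bounds this
  constant by \<open>b (h (d(y, q0)) + h D)\<close> (\<open>abs_primitive_dist_diff_le\<close>). This is integrable in \<open>y\<close>, so
  \<open>F\<close> is well defined and locally Lipschitz, and the Lipschitz constants of \<open>G n\<close> are controlled by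
  the averages of \<open>h (d(Y\<^sub>i, q0))\<close>. The strong law of large numbers gives, outside one null set,
  convergence of these averages and of \<open>G n q\<close> to \<open>F q\<close> for all \<open>q\<close> in a countable dense set. For
  each outcome outside that null set the rest is deterministic: for large \<open>n\<close> the \<open>G n\<close> are
  equicontinuous at every point, so approximate minimisers of \<open>G n\<close> accumulate only at minimisers of \<open>F\<close>
  (\<open>outer_limit_eps_argmin_subset\<close>).

  The strong law for i.i.d. integrable variables is derived from the statement that partial sums
  of variables with negative mean are almost surely bounded above (\<open>AE_bounded_excess\<close>).
  That follows from the argument behind the maximal ergodic theorem, run on the space of sequences.
\<close>

section \<open>Partial sums with negative mean\<close>

text \<open>
  The value \<^term>\<open>excess n x\<close> is the maximum of the partial sums
  \<open>x 0 + \<dots> + x (k - 1)\<close> over \<open>k \<le> n\<close>, the empty sum included. The recursion splits off the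
  first term instead of the last one, because the law of an i.i.d. sequence is reproduced when a
  fresh independent first term is put in front of it.
\<close>

fun excess :: "nat \<Rightarrow> (nat \<Rightarrow> real) \<Rightarrow> real" where
  "excess 0 x = 0"
| "excess (Suc n) x = max 0 (x 0 + excess n (\<lambda>i. x (Suc i)))"

lemma excess_nonneg: "0 \<le> excess n x"
  by (cases n) auto

lemma partial_sum_le_excess: "(\<Sum>i<n. x i) \<le> excess n x"
proof (induction n arbitrary: x)
  case (Suc n)
  show ?case
    using Suc[of "\<lambda>i. x (Suc i)"] by (simp add: sum.lessThan_Suc_shift del: sum.lessThan_Suc)
qed simp

lemma excess_le_sum_abs: "excess n x \<le> (\<Sum>i<n. \<bar>x i\<bar>)"
proof (induction n arbitrary: x)
  case (Suc n)
  show ?case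
    using Suc[of "\<lambda>i. x (Suc i)"]
    by (auto simp add: sum.lessThan_Suc_shift sum_nonneg simp del: sum.lessThan_Suc)
qed simp

lemma excess_le_Suc: "excess n x \<le> excess (Suc n) x"
proof (induction n arbitrary: x)
  case (Suc n)
  show ?case
    using Suc[of "\<lambda>i. x (Suc i)"] by simp
qed simp

lemma incseq_excess: "incseq (\<lambda>n. excess n x)"
  by (intro incseq_SucI excess_le_Suc)

lemma excess_case_nat: "excess (Suc n) (case_nat s w) = max 0 (s + excess n w)"
  by simp

declare excess.simps(2) [simp del]

lemma measurable_excess [measurable]:
  assumes [measurable_cong, simp]: "sets D = sets borel"
  shows "excess n \<in> borel_measurable (\<Pi>\<^sub>M i\<in>(UNIV::nat set). D)"
proof -
  \<comment> \<open>The recursion evaluates shifted sequences, so the induction covers all shifts.\<close>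
  have "(\<lambda>x. excess n (\<lambda>i. x (i + k))) \<in> borel_measurable (\<Pi>\<^sub>M i\<in>(UNIV::nat set). D)" for k
  proof (induction n arbitrary: k)
    case (Suc n)
    have 1: "(\<lambda>x::nat\<Rightarrow>real. x k) \<in> borel_measurable (\<Pi>\<^sub>M i\<in>(UNIV::nat set). D)"
      by simp
    show ?case
      using Suc[of "Suc k"] 1 by (simp add: excess.simps(2))
  qed simp
  from this[of 0] show ?thesis by simp
qed

text \<open>
  The barriers \<open>m\<close> range over the natural numbers so that measurability is a matter of countable
  operations.
\<close>

definition unbounded_excess :: "(nat \<Rightarrow> real) set" where
  "unbounded_excess = {x. \<forall>m::nat. \<exists>n. real m < excess n x}"

text \<open>
  One additional first term shifts all later partial sums by the same finite amount. Hence this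
  event does not depend on the first term, which makes it independent of it for i.i.d. sequences.
\<close>

lemma unbounded_excess_case_nat:
  "case_nat s w \<in> unbounded_excess \<longleftrightarrow> w \<in> unbounded_excess"
proof
  assume L: "case_nat s w \<in> unbounded_excess"
  show "w \<in> unbounded_excess"
    unfolding unbounded_excess_def
  proof (intro CollectI allI)
    fix m :: nat
    obtain k :: nat where k: "real m + \<bar>s\<bar> < real k" using reals_Archimedean2 by blast
    obtain n where n: "real k < excess n (case_nat s w)"
      using L unfolding unbounded_excess_def by blast
    have "excess n (case_nat s w) \<le> excess (Suc n) (case_nat s w)" by (rule excess_le_Suc)
    with n k have "real m < excess n w" unfolding excess_case_nat by linarith
    then show "\<exists>n. real m < excess n w" by blast
  qed
next
  assume R: "w \<in> unbounded_excess"
  show "case_nat s w \<in> unbounded_excess"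
    unfolding unbounded_excess_def
  proof (intro CollectI allI)
    fix m :: nat
    obtain k :: nat where k: "real m + \<bar>s\<bar> < real k" using reals_Archimedean2 by blast
    obtain n where n: "real k < excess n w"
      using R unfolding unbounded_excess_def by blast
    have "real m < excess (Suc n) (case_nat s w)"
      using n k unfolding excess_case_nat by linarith
    then show "\<exists>n. real m < excess n (case_nat s w)" by blast
  qed
qed

text \<open>
  The argument of the maximal ergodic theorem. Let \<open>A\<close> be the event that the partial sums are
  unbounded above and \<open>E n\<close> the excess. Put a fresh term \<open>s\<close> in front of a sequence \<open>w\<close>: the
  law does not change, \<open>A\<close> does not change, and the excess becomes \<open>max 0 (s + E n w)\<close>. Since the
  excess grows with \<open>n\<close>, the integral over \<open>A\<close> of \<open>max 0 (s + E n w) - E n w = max s (- E n w)\<close>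
  is nonnegative. On \<open>A\<close> this integrand tends to \<open>s\<close> and is dominated by \<open>\<bar>s\<bar>\<close>, so the
  integral of \<open>s\<close> over \<open>A\<close> is nonnegative; by independence it is the probability of \<open>A\<close> times the
  mean. A negative mean therefore forces \<open>A\<close> to be a null set.
\<close>

lemma AE_bounded_excess:
  fixes D :: "real measure"
  assumes "prob_space D" and sets_D [measurable_cong, simp]: "sets D = sets borel"
    and int: "integrable D (\<lambda>x. x)" and neg: "(\<integral>x. x \<partial>D) < 0"
  shows "AE x in (\<Pi>\<^sub>M i\<in>(UNIV::nat set). D). x \<notin> unbounded_excess"
proof -
  interpret D: prob_space D by fact
  interpret S: sequence_space D ..
  let ?S = "\<Pi>\<^sub>M i\<in>(UNIV::nat set). D" and ?A = unbounded_excess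
  interpret Q: pair_sigma_finite D ?S ..
  let ?P = "D \<Otimes>\<^sub>M ?S"
  have space_S [simp]: "space ?S = UNIV"
    using sets_eq_imp_space_eq[OF sets_D] by (auto simp: space_PiM)
  have A_eq: "?A = {x \<in> space ?S. \<forall>m::nat. \<exists>n. real m < excess n x}"
    by (simp add: unbounded_excess_def)
  have [measurable]: "?A \<in> sets ?S"
    unfolding A_eq by measurable
  have fst_P: "distr ?P D fst = D"
    by (rule S.P.distr_pair_fst)
  have snd_P: "distr ?P ?S snd = ?S"
  proof -
    have "distr ?P ?S snd = distr (distr (?S \<Otimes>\<^sub>M D) ?P (\<lambda>(x, y). (y, x))) ?S snd"
      by (subst Q.distr_pair_swap) simp
    also have "\<dots> = distr (?S \<Otimes>\<^sub>M D) ?S fst"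
      by (subst distr_distr) (auto simp: comp_def split_beta' intro!: distr_cong)
    also have "\<dots> = ?S" by (rule D.distr_pair_fst)
    finally show ?thesis .
  qed
  have int_S: "integrable ?S (excess n)" for n
  proof (rule Bochner_Integration.integrable_bound)
    have "integrable ?S (\<lambda>x. x i)" for i
      using integrable_distr[of "\<lambda>x. x i" ?S D "\<lambda>x. x"] S.PiM_component[of i] int by simp
    then show "integrable ?S (\<lambda>x. \<Sum>i<n. \<bar>x i\<bar>)"
      by auto
    show "AE x in ?S. norm (excess n x) \<le> norm (\<Sum>i<n. \<bar>x i\<bar>)"
      using excess_le_sum_abs[of n] excess_nonneg[of n] by (auto intro!: AE_I2 simp: sum_nonneg)
  qed measurable
  have fst_int: "integrable ?P fst"
    using integrable_distr[of fst ?P D "\<lambda>x. x"] int fst_P by simp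
  have int_A: "integrable ?S (\<lambda>w. indicator ?A w * excess n w)" for n
    using integrable_mult_indicator[of ?A ?S "excess n"] int_S by simp
  have int_snd: "integrable ?P (\<lambda>z. indicator ?A (snd z) * excess n (snd z))" for n
    using integrable_distr[of snd ?P ?S "\<lambda>w. indicator ?A w * excess n w"] int_A snd_P by simp
  have eq_snd: "(\<integral>w. indicator ?A w * excess n w \<partial>?S)
      = (\<integral>z. indicator ?A (snd z) * excess n (snd z) \<partial>?P)" for n
    using integral_distr[of snd ?P ?S "\<lambda>w. indicator ?A w * excess n w"] snd_P by simp
  \<comment> \<open>Prefixing a fresh term leaves both the law of the sequence and the event unchanged.\<close>
  have iter: "integrable ?P (\<lambda>z. indicator ?A (snd z) * max 0 (fst z + excess n (snd z)))
     \<and> (\<integral>w. indicator ?A w * excess (Suc n) w \<partial>?S)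
      = (\<integral>z. indicator ?A (snd z) * max 0 (fst z + excess n (snd z)) \<partial>?P)" for n
  proof -
    let ?f = "\<lambda>w. indicator ?A w * excess (Suc n) w" and ?g = "\<lambda>(s, w). case_nat s w :: nat \<Rightarrow> real"
    have [measurable]: "?g \<in> ?P \<rightarrow>\<^sub>M ?S" by measurable
    have [measurable]: "?f \<in> borel_measurable ?S" by (intro borel_measurable_times) simp_all
    have eq: "?f (?g z) = indicator ?A (snd z) * max 0 (fst z + excess n (snd z))" for z
      by (cases z) (simp add: excess_case_nat unbounded_excess_case_nat indicator_def)
    have "integrable (distr ?P ?S ?g) ?f"
      unfolding S.PiM_iter by (rule int_A)
    then have "integrable ?P (\<lambda>z. ?f (?g z))"
      by (rule integrable_distr[rotated]) simp
    moreover have "(\<integral>w. ?f w \<partial>distr ?P ?S ?g) = (\<integral>z. ?f (?g z) \<partial>?P)"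
      by (rule integral_distr) simp_all
    ultimately show ?thesis
      unfolding eq S.PiM_iter by blast
  qed
  let ?u = "\<lambda>n z. indicator ?A (snd z) * max (fst z) (- excess n (snd z)) :: real"
  have nonneg: "0 \<le> (\<integral>z. ?u n z \<partial>?P)" for n
  proof -
    have "(\<integral>w. indicator ?A w * excess n w \<partial>?S) \<le> (\<integral>w. indicator ?A w * excess (Suc n) w \<partial>?S)"
      by (intro integral_mono int_A mult_left_mono excess_le_Suc) simp
    then have "0 \<le> (\<integral>z. indicator ?A (snd z) * max 0 (fst z + excess n (snd z))
        - indicator ?A (snd z) * excess n (snd z) \<partial>?P)"
      using iter[of n] eq_snd[of n] int_snd[of n] by (subst Bochner_Integration.integral_diff) auto
    also have "\<dots> = (\<integral>z. ?u n z \<partial>?P)"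
      by (intro Bochner_Integration.integral_cong) (auto simp: indicator_def)
    finally show ?thesis .
  qed
  \<comment> \<open>On the event the excess eventually exceeds \<open>- s\<close>, where the integrand has become \<open>s\<close>.\<close>
  have "(\<lambda>n. \<integral>z. ?u n z \<partial>?P) \<longlonglongrightarrow> (\<integral>z. indicator ?A (snd z) * fst z \<partial>?P)"
  proof (rule integral_dominated_convergence)
    show "integrable ?P (\<lambda>z. \<bar>fst z\<bar>)" using fst_int by simp
    show "AE z in ?P. (\<lambda>n. ?u n z) \<longlonglongrightarrow> indicator ?A (snd z) * fst z"
    proof (intro AE_I2)
      fix z
      show "(\<lambda>n. ?u n z) \<longlonglongrightarrow> indicator ?A (snd z) * fst z"
      proof (cases "snd z \<in> ?A")
        case True
        obtain k :: nat where k: "- fst z < real k" using reals_Archimedean2 by blast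
        obtain N where "real k < excess N (snd z)"
          using True unfolding unbounded_excess_def by blast
        then have "- excess n (snd z) \<le> fst z" if "N \<le> n" for n
          using incseqD[OF incseq_excess that, of "snd z"] k by linarith
        then have "max (fst z) (- excess n (snd z)) = fst z" if "N \<le> n" for n
          using that by (simp add: max_absorb1)
        then have "\<forall>\<^sub>F n in sequentially. ?u n z = indicator ?A (snd z) * fst z"
          unfolding eventually_sequentially by (intro exI[of _ N]) simp
        then show ?thesis by (rule tendsto_eventually)
      qed simp
    qed
    show "AE z in ?P. norm (?u n z) \<le> \<bar>fst z\<bar>" for n
    proof (intro AE_I2)
      fix z
      show "norm (?u n z) \<le> \<bar>fst z\<bar>"
        using excess_nonneg[of n "snd z"] by (simp add: indicator_def max_def abs_if)
    qed
  qed (use fst_int in \<open>simp_all add: borel_measurable_integrable\<close>)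
  then have "0 \<le> (\<integral>z. indicator ?A (snd z) * fst z \<partial>?P)"
    by (rule LIMSEQ_le_const) (use nonneg in blast)
  also have "\<dots> = (\<integral>s. (\<integral>w. indicator ?A w * s \<partial>?S) \<partial>D)"
  proof -
    have "integrable ?P (\<lambda>(s, w). indicator ?A w * s)"
      using fst_int by (rule Bochner_Integration.integrable_bound)
        (auto simp: indicator_def intro!: AE_I2)
    from Q.integral_fst[OF this] show ?thesis by (simp add: split_beta')
  qed
  also have "\<dots> = measure ?S ?A * (\<integral>s. s \<partial>D)"
    by simp
  finally have "measure ?S ?A = 0"
    using neg measure_nonneg[of ?S ?A] by (simp add: zero_le_mult_iff)
  then show ?thesis
    by (subst AE_iff_measurable[OF _ refl]) (auto simp: S.P.emeasure_eq_measure)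
qed

section \<open>The strong law of large numbers\<close>

lemma (in prob_space) AE_partial_sums_bounded:
  fixes X :: "nat \<Rightarrow> 'a \<Rightarrow> real"
  assumes indep: "indep_vars (\<lambda>_. borel) X UNIV"
    and law: "\<And>i. distr M borel (X i) = distr M borel (X 0)"
    and int: "integrable M (X 0)" and neg: "expectation (X 0) < 0"
  shows "AE \<omega> in M. \<exists>B. \<forall>n. (\<Sum>i<n. X i \<omega>) \<le> B"
proof -
  let ?D = "distr M borel (X 0)"
  have rv [measurable]: "X i \<in> borel_measurable M" for i
    using indep by (simp add: indep_vars_def)
  have joint: "distr M (\<Pi>\<^sub>M i\<in>UNIV. borel) (\<lambda>\<omega> i. X i \<omega>) = (\<Pi>\<^sub>M i\<in>UNIV. ?D)"
  proof -
    have "(\<lambda>i. distr M borel (X i)) = (\<lambda>i. ?D)"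
      using law by (rule ext)
    then show ?thesis
      using indep indep_vars_iff_distr_eq_PiM[where I = UNIV and M' = "\<lambda>_. borel" and X = X]
      by (simp add: restrict_UNIV)
  qed
  have "AE x in (\<Pi>\<^sub>M i\<in>(UNIV::nat set). ?D). x \<notin> unbounded_excess"
    using int neg
    by (intro AE_bounded_excess prob_space_distr) (simp_all add: integrable_distr_eq integral_distr)
  then have "AE x in distr M (\<Pi>\<^sub>M i\<in>UNIV. borel) (\<lambda>\<omega> i. X i \<omega>). x \<notin> unbounded_excess"
    unfolding joint .
  then have "AE \<omega> in M. (\<lambda>i. X i \<omega>) \<notin> unbounded_excess"
    by (rule AE_distrD[rotated]) (rule measurable_PiM_single', simp_all)
  then show ?thesis
  proof eventually_elim
    case (elim \<omega>)
    then obtain m :: nat where m: "excess n (\<lambda>i. X i \<omega>) \<le> real m" for n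
      unfolding unbounded_excess_def by (auto simp: not_less)
    then show ?case
      using partial_sum_le_excess[of "\<lambda>i. X i \<omega>"] by (meson order_trans)
  qed
qed

text \<open>
  After subtracting a constant slightly larger than the mean, the terms have negative mean. Their
  partial sums are then bounded above, so their averages are at most \<open>B / n\<close>. Countably many
  constants suffice, which keeps the exceptional set null.
\<close>

lemma (in prob_space) AE_averages_upper_bound:
  fixes X :: "nat \<Rightarrow> 'a \<Rightarrow> real"
  assumes indep: "indep_vars (\<lambda>_. borel) X UNIV"
    and law: "\<And>i. distr M borel (X i) = distr M borel (X 0)"
    and int: "integrable M (X 0)"
  shows "AE \<omega> in M. \<forall>c>expectation (X 0). \<forall>\<^sub>F n in sequentially. (\<Sum>i<n. X i \<omega>) / real n < c"
proof -
  have rv [measurable]: "X i \<in> borel_measurable M" for i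
    using indep by (simp add: indep_vars_def)
  let ?c = "\<lambda>k. expectation (X 0) + 1 / real (Suc k)"
  have "AE \<omega> in M. \<exists>B. \<forall>n. (\<Sum>i<n. X i \<omega> - ?c k) \<le> B" for k
  proof (rule AE_partial_sums_bounded)
    show "indep_vars (\<lambda>_. borel) (\<lambda>i \<omega>. X i \<omega> - ?c k) UNIV"
      using indep by (rule indep_vars_compose2) simp
    show "distr M borel (\<lambda>\<omega>. X i \<omega> - ?c k) = distr M borel (\<lambda>\<omega>. X 0 \<omega> - ?c k)" for i
    proof -
      have "distr (distr M borel (X i)) borel (\<lambda>x. x - ?c k)
          = distr (distr M borel (X 0)) borel (\<lambda>x. x - ?c k)"
        by (simp only: law[of i])
      then show ?thesis
        by (simp add: distr_distr comp_def)
    qed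
    show "integrable M (\<lambda>\<omega>. X 0 \<omega> - ?c k)" using int by simp
    have "expectation (\<lambda>\<omega>. X 0 \<omega> - ?c k) = - (1 / real (Suc k))"
      using int by (subst Bochner_Integration.integral_diff) (simp_all add: prob_space)
    then show "expectation (\<lambda>\<omega>. X 0 \<omega> - ?c k) < 0"
      by simp
  qed
  then have "AE \<omega> in M. \<forall>k. \<exists>B. \<forall>n. (\<Sum>i<n. X i \<omega> - ?c k) \<le> B"
    unfolding AE_all_countable by blast
  then show ?thesis
  proof eventually_elim
    case (elim \<omega>)
    show ?case
    proof (intro allI impI)
      fix c assume "expectation (X 0) < c"
      then obtain k where k: "?c k < c"
        using reals_Archimedean[of "c - expectation (X 0)"] by (auto simp: field_simps)
      obtain B where B: "(\<Sum>i<n. X i \<omega> - ?c k) \<le> B" for n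
        using elim by blast
      have "(\<lambda>n. B / real n + ?c k) \<longlonglongrightarrow> 0 + ?c k"
        by (intro tendsto_intros lim_const_over_n)
      then have "\<forall>\<^sub>F n in sequentially. B / real n + ?c k < c"
        using k by (intro order_tendstoD) simp_all
      then show "\<forall>\<^sub>F n in sequentially. (\<Sum>i<n. X i \<omega>) / real n < c"
        using eventually_gt_at_top[of 0]
      proof eventually_elim
        case (elim n)
        have "(\<Sum>i<n. X i \<omega>) \<le> B + real n * ?c k"
          using B[of n] by (simp add: sum_subtractf)
        then have "(\<Sum>i<n. X i \<omega>) / real n \<le> (B + real n * ?c k) / real n"
          by (rule divide_right_mono) simp
        also have "\<dots> = B / real n + ?c k"
          using \<open>0 < n\<close> by (simp add: add_divide_distrib)
        finally show ?case using elim by simp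
      qed
    qed
  qed
qed

text \<open>
  The upper bound, applied to the sequence and to its negative.
\<close>

theorem (in prob_space) strong_law_of_large_numbers:
  fixes X :: "nat \<Rightarrow> 'a \<Rightarrow> real"
  assumes indep: "indep_vars (\<lambda>_. borel) X UNIV"
    and law: "\<And>i. distr M borel (X i) = distr M borel (X 0)"
    and int: "integrable M (X 0)"
  shows "AE \<omega> in M. (\<lambda>n. (\<Sum>i<n. X i \<omega>) / real n) \<longlonglongrightarrow> expectation (X 0)"
proof -
  have rv [measurable]: "X i \<in> borel_measurable M" for i
    using indep by (simp add: indep_vars_def)
  have upper: "AE \<omega> in M. \<forall>c>expectation (X 0). \<forall>\<^sub>F n in sequentially. (\<Sum>i<n. X i \<omega>) / real n < c"
    using assms by (rule AE_averages_upper_bound)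
  have lower: "AE \<omega> in M. \<forall>c>expectation (\<lambda>\<omega>. - X 0 \<omega>).
      \<forall>\<^sub>F n in sequentially. (\<Sum>i<n. - X i \<omega>) / real n < c"
  proof (rule AE_averages_upper_bound)
    show "indep_vars (\<lambda>_. borel) (\<lambda>i \<omega>. - X i \<omega>) UNIV"
      using indep by (rule indep_vars_compose2) simp
    show "distr M borel (\<lambda>\<omega>. - X i \<omega>) = distr M borel (\<lambda>\<omega>. - X 0 \<omega>)" for i
    proof -
      have "distr (distr M borel (X i)) borel uminus = distr (distr M borel (X 0)) borel uminus"
        by (simp only: law[of i])
      then show ?thesis
        by (simp add: distr_distr comp_def)
    qed
  qed (use int in simp)
  from upper lower show ?thesis
  proof eventually_elim
    case (elim \<omega>)
    show ?case
    proof (rule order_tendstoI)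
      fix c assume "c < expectation (X 0)"
      then have "\<forall>\<^sub>F n in sequentially. (\<Sum>i<n. - X i \<omega>) / real n < - c"
        using elim(2) by simp
      then show "\<forall>\<^sub>F n in sequentially. c < (\<Sum>i<n. X i \<omega>) / real n"
        by (simp add: sum_negf)
    qed (use elim(1) in blast)
  qed
qed

section \<open>The strong law for functions of a sample\<close>

lemma (in prob_space) indep_vars_reindex:
  assumes "inj_on f I" and indep: "indep_vars M' X (f ` I)"
  shows "indep_vars (\<lambda>i. M' (f i)) (\<lambda>i. X (f i)) I"
proof -
  let ?F = "\<lambda>i. {X i -` A \<inter> space M |A. A \<in> sets (M' i)}"
  have "indep_sets (\<lambda>i. ?F (f i)) I"
  proof (rule indep_setsI)
    fix A J assume J: "J \<noteq> {}" "J \<subseteq> I" "finite J" and A: "\<forall>j\<in>J. A j \<in> ?F (f j)"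
    have inj: "inj_on f J" using assms(1) J(2) by (rule inj_on_subset)
    let ?B = "\<lambda>k. A (the_inv_into J f k)"
    have B: "?B (f j) = A j" if "j \<in> J" for j
      using inj that by (simp add: the_inv_into_f_f)
    have "prob (\<Inter>k\<in>f ` J. ?B k) = (\<Prod>k\<in>f ` J. prob (?B k))"
      using indep J A B unfolding indep_vars_def2 by (intro indep_setsD[of ?F "f ` I"]) auto
    then show "prob (\<Inter>j\<in>J. A j) = (\<Prod>j\<in>J. prob (A j))"
      using B inj by (simp add: prod.reindex)
  qed (use indep in \<open>auto simp: indep_vars_def2 measurable_sets\<close>)
  then show ?thesis
    using indep by (auto simp: indep_vars_def2)
qed

text \<open>
  The form used for statistical functionals: samples with values in an arbitrary measurable space,
  numbered from 1, and an integrable real function of them.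
\<close>

theorem strong_law_of_large_numbers_compose:
  fixes Y :: "'w \<Rightarrow> 'b" and Ys :: "nat \<Rightarrow> 'w \<Rightarrow> 'b" and f :: "'b \<Rightarrow> real"
  assumes "prob_space P" and [measurable]: "Y \<in> P \<rightarrow>\<^sub>M N"
    and indep: "prob_space.indep_vars P (\<lambda>_. N) Ys {1..}"
    and law: "\<And>i. i \<ge> 1 \<Longrightarrow> distr P N (Ys i) = distr P N Y"
    and f [measurable]: "f \<in> borel_measurable N" and int: "integrable P (\<lambda>\<omega>. f (Y \<omega>))"
  shows "AE \<omega> in P. (\<lambda>n. 1 / real n * (\<Sum>i=1..n. f (Ys i \<omega>))) \<longlonglongrightarrow> (\<integral>\<omega>. f (Y \<omega>) \<partial>P)"
proof -
  interpret prob_space P by fact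
  have rv [measurable]: "Ys (Suc i) \<in> P \<rightarrow>\<^sub>M N" for i
    using indep by (simp add: indep_vars_def)
  have law': "distr P borel (\<lambda>\<omega>. f (Ys (Suc i) \<omega>)) = distr P borel (\<lambda>\<omega>. f (Y \<omega>))" for i
  proof -
    have "distr (distr P N (Ys (Suc i))) borel f = distr (distr P N Y) borel f"
      by (simp only: law[of "Suc i"])
    then show ?thesis
      by (simp add: distr_distr comp_def)
  qed
  have int': "integrable P (\<lambda>\<omega>. f (Ys (Suc 0) \<omega>))"
    using int law[of "Suc 0"] integrable_distr_eq[of "Ys (Suc 0)" P N f] integrable_distr_eq[of Y P N f] by simp
  have mean: "(\<integral>\<omega>. f (Ys (Suc 0) \<omega>) \<partial>P) = (\<integral>\<omega>. f (Y \<omega>) \<partial>P)"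
    using law[of "Suc 0"] integral_distr[of "Ys (Suc 0)" P N f] integral_distr[of Y P N f] by simp
  have "AE \<omega> in P. (\<lambda>n. (\<Sum>i<n. f (Ys (Suc i) \<omega>)) / real n) \<longlonglongrightarrow> (\<integral>\<omega>. f (Ys (Suc 0) \<omega>) \<partial>P)"
  proof (rule strong_law_of_large_numbers)
    have "Suc ` UNIV = {1..}" by (auto simp: image_iff Suc_le_D)
    then have "indep_vars (\<lambda>_. N) (\<lambda>i. Ys (Suc i)) UNIV"
      using indep_vars_reindex[of Suc UNIV "\<lambda>_. N" Ys] indep by (simp del: One_nat_def)
    then show "indep_vars (\<lambda>_. borel) (\<lambda>i \<omega>. f (Ys (Suc i) \<omega>)) UNIV"
      by (rule indep_vars_compose2) simp
  qed (simp_all only: law' int')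
  moreover have "(\<Sum>i<n. f (Ys (Suc i) \<omega>)) = (\<Sum>i=1..n. f (Ys i \<omega>))" for n \<omega>
    using sum.shift_bounds_Suc_ivl[of "\<lambda>i. f (Ys i \<omega>)" 0 n]
    by (simp add: atLeast0LessThan atLeastLessThanSuc_atLeastAtMost)
  ultimately show ?thesis
    unfolding mean by (simp del: One_nat_def)
qed

section \<open>Doubling rates and their primitives\<close>

locale doubling_rate =
  fixes h :: "real \<Rightarrow> real" and b :: real
  assumes nonneg: "0 \<le> x \<Longrightarrow> 0 \<le> h x"
    and mono: "mono_on {0..} h"
    and b_ge_1: "1 \<le> b"
    and doubling: "0 \<le> x \<Longrightarrow> h (2 * x) \<le> b * h x"
begin

lemma le: "0 \<le> x \<Longrightarrow> x \<le> y \<Longrightarrow> h x \<le> h y"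
  using mono by (auto simp: mono_on_def)

text \<open>
  Nothing is known about the rate on the negative reals. Extending it by the constant
  \<^term>\<open>h 0\<close> gives a function that is monotone on the whole line and thus Borel.
\<close>

lemma measurable_extension: "(\<lambda>x. h (max 0 x)) \<in> borel_measurable borel"
  by (rule borel_measurable_mono) (auto simp: mono_def intro!: le)

lemma set_integrable_Icc: "set_integrable lborel {0..x} h"
proof -
  have eq: "indicator {0..x} t *\<^sub>R h t = indicator {0..x} t * h (max 0 t)" for t
    by (simp add: indicator_def)
  have "integrable lborel (\<lambda>t. indicator {0..x} t * h (max 0 t))"
  proof (rule Bochner_Integration.integrable_bound)
    show "integrable lborel (\<lambda>t. indicator {0..x} t * h x)"
      by (intro integrable_mult_left integrable_real_indicator) (simp_all add: emeasure_lborel_Icc_eq)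
    show "(\<lambda>t. indicator {0..x} t * h (max 0 t)) \<in> borel_measurable lborel"
      using measurable_extension by simp
    show "AE t in lborel. norm (indicator {0..x} t * h (max 0 t)) \<le> norm (indicator {0..x} t * h x)"
      using nonneg le by (intro AE_I2) (auto simp: indicator_def intro: order_trans)
  qed
  then show ?thesis unfolding set_integrable_def eq .
qed

lemma primitive_diff_bounds:
  assumes "0 \<le> x" "x \<le> y"
  shows "0 \<le> primitive h y - primitive h x" "primitive h y - primitive h x \<le> (y - x) * h y"
proof -
  have int: "set_integrable lborel {x<..y} h"
    by (rule set_integrable_subset[OF set_integrable_Icc[of y]]) (use assms in auto)
  have "primitive h y = (LBINT t:{0..x} \<union> {x<..y}. h t)"
    unfolding primitive_def using assms by (simp add: ivl_disj_un)
  also have "\<dots> = primitive h x + (LBINT t:{x<..y}. h t)"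
    unfolding primitive_def by (rule set_integral_Un) (auto intro: set_integrable_Icc int)
  finally have eq: "primitive h y - primitive h x = (LBINT t:{x<..y}. h t)"
    by simp
  show "0 \<le> primitive h y - primitive h x"
    unfolding eq set_lebesgue_integral_def
    using assms nonneg by (intro Bochner_Integration.integral_nonneg) (auto simp: indicator_def)
  have "(LBINT t:{x<..y}. h t) \<le> (LBINT t:{x<..y}. h y)"
    using int assms by (intro set_integral_mono) (auto simp: set_integrable_def intro!: le)
  also have "\<dots> = (y - x) * h y"
    using assms by (simp add: set_lebesgue_integral_def)
  finally show "primitive h y - primitive h x \<le> (y - x) * h y"
    unfolding eq .
qed

lemma primitive_neg: "x < 0 \<Longrightarrow> primitive h x = 0"
  by (simp add: primitive_def set_lebesgue_integral_def)

lemma primitive_nonneg: "0 \<le> primitive h x"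
  unfolding primitive_def set_lebesgue_integral_def
  using nonneg by (intro Bochner_Integration.integral_nonneg) (auto simp: indicator_def)

lemma measurable_primitive [measurable]: "primitive h \<in> borel_measurable borel"
proof (rule borel_measurable_mono, rule monoI)
  fix x y :: real assume "x \<le> y"
  then show "primitive h x \<le> primitive h y"
    using primitive_diff_bounds(1)[of x y] by (cases "0 \<le> x") (simp_all add: primitive_neg primitive_nonneg)
qed

lemma abs_primitive_diff_le:
  assumes "0 \<le> x" "0 \<le> y"
  shows "\<bar>primitive h x - primitive h y\<bar> \<le> \<bar>x - y\<bar> * h (max x y)"
  using primitive_diff_bounds[of x y] primitive_diff_bounds[of y x] assms
  by (cases "x \<le> y") (simp_all add: abs_if max_def)

text \<open>
  The doubling condition enters only through this quasi-subadditivity: it bounds the rate at a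
  displaced point by the rate at the original point, up to a constant.
\<close>

lemma add_le:
  assumes "0 \<le> x" "0 \<le> y"
  shows "h (x + y) \<le> b * (h x + h y)"
proof -
  have "h (x + y) \<le> h (2 * max x y)" using assms by (intro le) auto
  also have "\<dots> \<le> b * h (max x y)" using assms by (intro doubling) auto
  also have "\<dots> \<le> b * (h x + h y)"
    using nonneg[of x] nonneg[of y] assms b_ge_1 by (intro mult_left_mono) (auto simp: max_def)
  finally show ?thesis .
qed

text \<open>
  The loss is Lipschitz in the location on every ball around \<open>q0\<close>, with a constant that depends
  on the observation \<open>y\<close> only through \<^term>\<open>h (dist y q0)\<close>. The integrability hypothesis on the
  rate is made for exactly this quantity; the primitive of the rate may well have infinite mean.
\<close>

lemma abs_primitive_dist_diff_le:
  fixes y p q q0 :: "'a::metric_space"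
  assumes "dist p q0 \<le> D" "dist q q0 \<le> D"
  shows "\<bar>primitive h (dist y p) - primitive h (dist y q)\<bar> \<le> dist p q * (b * (h (dist y q0) + h D))"
proof -
  have D: "0 \<le> D" using assms(1) zero_le_dist order_trans by blast
  have "\<bar>primitive h (dist y p) - primitive h (dist y q)\<bar>
      \<le> \<bar>dist y p - dist y q\<bar> * h (max (dist y p) (dist y q))"
    by (rule abs_primitive_diff_le) simp_all
  also have "\<dots> \<le> dist p q * h (dist y q0 + D)"
  proof (intro mult_mono le nonneg)
    show "\<bar>dist y p - dist y q\<bar> \<le> dist p q"
      using dist_triangle[of y p q] dist_triangle[of y q p] by (simp add: abs_le_iff dist_commute)
    show "max (dist y p) (dist y q) \<le> dist y q0 + D"
      using assms dist_triangle2[of y p q0] dist_triangle2[of y q q0] dist_commute[of p] dist_commute[of q]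
      by (auto intro: order_trans)
  qed (simp_all add: le_max_iff_disj)
  also have "\<dots> \<le> dist p q * (b * (h (dist y q0) + h D))"
    using D by (intro mult_left_mono add_le) simp_all
  finally show ?thesis .
qed

end

section \<open>Outer limits of approximate minimisers\<close>

text \<open>
  If approximate minimisers \<open>q'\<close> of \<^term>\<open>G k\<close> come close to \<open>q\<close> for arbitrarily large \<open>k\<close>, then
  \<^term>\<open>G k q'\<close> is close to \<^term>\<open>F q\<close> by equicontinuity, and it is at most
  \<^term>\<open>\<epsilon> k + G k p\<close> for any competitor \<open>p\<close>. In the limit this reads \<^term>\<open>F q \<le> F p\<close>. Pointwise
  convergence on a dense set is enough, since equicontinuity spreads it to the whole space.
\<close>

lemma outer_limit_eps_argmin_subset:
  fixes F :: "'a::metric_space \<Rightarrow> real" and G :: "nat \<Rightarrow> 'a \<Rightarrow> real"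
  assumes dense: "closure Q = UNIV"
    and conv: "\<And>q. q \<in> Q \<Longrightarrow> (\<lambda>n. G n q) \<longlonglongrightarrow> F q"
    and equicont: "\<And>q e. 0 < e \<Longrightarrow>
      \<exists>r>0. \<forall>\<^sub>F n in sequentially. \<forall>p. dist p q < r \<longrightarrow> \<bar>G n p - G n q\<bar> < e"
    and cont: "\<And>q e. 0 < e \<Longrightarrow> \<exists>r>0. \<forall>p. dist p q < r \<longrightarrow> \<bar>F p - F q\<bar> < e"
    and eps: "\<epsilon> \<longlonglongrightarrow> 0"
  shows "outer_limit (\<lambda>n. eps_argmin_set (\<epsilon> n) (G n)) \<subseteq> argmin_set F"
proof
  \<comment> \<open>Convergence at every point, by comparison with a nearby point of the dense set.\<close>
  have conv': "\<forall>\<^sub>F n in sequentially. \<bar>G n q - F q\<bar> < e" if "0 < e" for q e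
  proof -
    have e: "0 < e / 3" using that by simp
    obtain r where r: "0 < r"
        "\<forall>\<^sub>F n in sequentially. \<forall>p. dist p q < r \<longrightarrow> \<bar>G n p - G n q\<bar> < e / 3"
      using equicont[OF e] by blast
    obtain s where s: "0 < s" "\<And>p. dist p q < s \<Longrightarrow> \<bar>F p - F q\<bar> < e / 3"
      using cont[OF e] by blast
    obtain p where p: "p \<in> Q" "dist p q < min r s"
      using dense r(1) s(1) closure_approachable[of q Q] by (metis UNIV_I min_less_iff_conj)
    have "\<forall>\<^sub>F n in sequentially. \<bar>G n p - F p\<bar> < e / 3"
      using tendstoD[OF conv[OF p(1)] e] by (simp add: dist_real_def)
    with r(2) show ?thesis
    proof eventually_elim
      case (elim n)
      then have "\<bar>G n p - G n q\<bar> < e / 3" using p(2) by simp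
      with elim(2) s(2)[of p] p(2) show ?case by (simp add: abs_if split: if_splits)
    qed
  qed
  fix q assume q: "q \<in> outer_limit (\<lambda>n. eps_argmin_set (\<epsilon> n) (G n))"
  have "F q \<le> F p" for p
  proof (rule field_le_epsilon)
    fix e :: real assume "0 < e"
    then have e: "0 < e / 5" by simp
    obtain r where r: "0 < r"
        "\<forall>\<^sub>F n in sequentially. \<forall>p. dist p q < r \<longrightarrow> \<bar>G n p - G n q\<bar> < e / 5"
      using equicont[OF e] by blast
    have "\<forall>\<^sub>F n in sequentially. \<epsilon> n < e / 5"
      using order_tendstoD(2)[OF eps e] .
    then have "\<forall>\<^sub>F n in sequentially. n \<ge> 1 \<and> \<epsilon> n < e / 5 \<and> \<bar>G n q - F q\<bar> < e / 5 \<and> \<bar>G n p - F p\<bar> < e / 5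
        \<and> (\<forall>p. dist p q < r \<longrightarrow> \<bar>G n p - G n q\<bar> < e / 5)"
      using conv'[OF e] r(2) eventually_ge_at_top[of 1] by (auto simp: eventually_conj_iff)
    then obtain N where N: "\<And>n. N \<le> n \<Longrightarrow> n \<ge> 1 \<and> \<epsilon> n < e / 5 \<and> \<bar>G n q - F q\<bar> < e / 5
        \<and> \<bar>G n p - F p\<bar> < e / 5 \<and> (\<forall>p. dist p q < r \<longrightarrow> \<bar>G n p - G n q\<bar> < e / 5)"
      unfolding eventually_sequentially by blast
    have "q \<in> closure (\<Union>k\<in>{N..}. eps_argmin_set (\<epsilon> k) (G k))"
      using q N[of N] by (auto simp: outer_limit_def)
    then obtain k q' where k: "N \<le> k" and q': "q' \<in> eps_argmin_set (\<epsilon> k) (G k)" "dist q' q < r"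
      using r(1) unfolding closure_approachable by fastforce
    have "ereal (G k q') \<le> ereal (\<epsilon> k) + (INF p. ereal (G k p))"
      using q'(1) by (simp add: eps_argmin_set_def)
    also have "\<dots> \<le> ereal (\<epsilon> k) + ereal (G k p)"
      by (intro add_left_mono INF_lower) simp
    finally have "G k q' \<le> \<epsilon> k + G k p" by simp
    moreover have "\<bar>G k q' - G k q\<bar> < e / 5" using N[OF k] q'(2) by blast
    ultimately show "F q \<le> F p + e"
      using N[OF k] by linarith
  qed
  then show "q \<in> argmin_set F"
    unfolding argmin_set_def by (auto intro!: antisym INF_greatest intro: INF_lower)
qed

section \<open>Population and empirical objectives\<close>

lemma lipschitz_bound_small:
  fixes C e :: real
  assumes "0 < e" "0 \<le> C"
  obtains r where "0 < r" "r \<le> 1" "r * C < e"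
proof
  show "0 < min 1 (e / (C + 1))" using assms by simp
  have "min 1 (e / (C + 1)) * C \<le> e / (C + 1) * C"
    using assms by (intro mult_right_mono) auto
  also have "\<dots> < e" using assms by (simp add: field_simps)
  finally show "min 1 (e / (C + 1)) * C < e" .
qed simp

locale doubling_mean = doubling_rate +
  fixes P :: "'w measure" and Y :: "'w \<Rightarrow> 'a::polish_space" and q0 :: 'a
  assumes prob_P: "prob_space P"
    and measurable_Y [measurable]: "Y \<in> borel_measurable P"
    and integrable_rate: "integrable P (\<lambda>\<omega>. h (dist (Y \<omega>) q0))"
begin

abbreviation loss :: "'a \<Rightarrow> 'a \<Rightarrow> real" where
  "loss q y \<equiv> primitive h (dist y q) - primitive h (dist y q0)"

abbreviation "mean_rate \<equiv> (\<integral>\<omega>. h (dist (Y \<omega>) q0) \<partial>P)"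

lemma measurable_loss: "loss q \<in> borel_measurable borel"
  by measurable

lemma measurable_rate: "(\<lambda>y. h (dist y q0)) \<in> borel_measurable borel"
proof -
  have "(\<lambda>y. h (max 0 (dist y q0))) \<in> borel_measurable borel"
    by (rule measurable_compose[OF _ measurable_extension]) simp
  then show ?thesis by simp
qed

lemma abs_loss_diff_le:
  assumes "dist p q0 \<le> D" "dist q q0 \<le> D"
  shows "\<bar>loss p y - loss q y\<bar> \<le> dist p q * (b * (h (dist y q0) + h D))"
  using abs_primitive_dist_diff_le[OF assms] by simp

text \<open>
  Subtracting the loss at \<open>q0\<close> is what makes the loss at \<open>q\<close> integrable: the difference is bounded
  by a multiple of the rate.
\<close>

lemma integrable_loss: "integrable P (\<lambda>\<omega>. loss q (Y \<omega>))"
proof (rule Bochner_Integration.integrable_bound)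
  interpret prob_space P by (rule prob_P)
  show "integrable P (\<lambda>\<omega>. dist q q0 * (b * (h (dist (Y \<omega>) q0) + h (dist q q0))))"
    using integrable_rate by simp
  show "AE \<omega> in P. norm (loss q (Y \<omega>)) \<le> norm (dist q q0 * (b * (h (dist (Y \<omega>) q0) + h (dist q q0))))"
    using abs_primitive_dist_diff_le[of q q0 "dist q q0" q0] by (auto intro!: AE_I2 intro: order_trans[OF _ abs_ge_self])
qed measurable

lemma abs_population_diff_le:
  assumes "dist p q0 \<le> D" "dist q q0 \<le> D"
  shows "\<bar>population_objective P (primitive h) Y q0 p - population_objective P (primitive h) Y q0 q\<bar>
    \<le> dist p q * (b * (mean_rate + h D))"
proof -
  interpret prob_space P by (rule prob_P)
  have "\<bar>population_objective P (primitive h) Y q0 p - population_objective P (primitive h) Y q0 q\<bar>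
      = \<bar>\<integral>\<omega>. loss p (Y \<omega>) - loss q (Y \<omega>) \<partial>P\<bar>"
    unfolding population_objective_def
    by (subst Bochner_Integration.integral_diff[OF integrable_loss integrable_loss]) simp
  also have "\<dots> \<le> (\<integral>\<omega>. \<bar>loss p (Y \<omega>) - loss q (Y \<omega>)\<bar> \<partial>P)"
    by (rule integral_abs_bound)
  also have "\<dots> \<le> (\<integral>\<omega>. dist p q * (b * (h (dist (Y \<omega>) q0) + h D)) \<partial>P)"
    using integrable_rate abs_loss_diff_le[OF assms]
    by (intro integral_mono integrable_abs Bochner_Integration.integrable_diff integrable_loss) simp_all
  also have "\<dots> = dist p q * (b * (mean_rate + h D))"
    using integrable_rate by (simp add: prob_space)
  finally show ?thesis .
qed

lemma abs_empirical_diff_le: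
  assumes "dist p q0 \<le> D" "dist q q0 \<le> D" "1 \<le> n"
  shows "\<bar>empirical_objective (primitive h) y q0 n p - empirical_objective (primitive h) y q0 n q\<bar>
    \<le> dist p q * (b * (1 / real n * (\<Sum>i=1..n. h (dist (y i) q0)) + h D))"
proof -
  have "\<bar>empirical_objective (primitive h) y q0 n p - empirical_objective (primitive h) y q0 n q\<bar>
      = 1 / real n * \<bar>\<Sum>i=1..n. loss p (y i) - loss q (y i)\<bar>"
    unfolding empirical_objective_def right_diff_distrib[symmetric] sum_subtractf[symmetric]
    by (simp add: abs_mult)
  also have "\<dots> \<le> 1 / real n * (\<Sum>i=1..n. dist p q * (b * (h (dist (y i) q0) + h D)))"
    using abs_loss_diff_le[OF assms(1,2)]
    by (intro mult_left_mono order_trans[OF sum_abs] sum_mono) simp_all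
  also have "\<dots> = dist p q * (b * (1 / real n * (\<Sum>i=1..n. h (dist (y i) q0)) + h D))"
    using assms(3) by (simp add: sum_distrib_left[symmetric] sum.distrib field_simps)
  finally show ?thesis .
qed

lemma mean_rate_nonneg: "0 \<le> mean_rate"
  by (intro Bochner_Integration.integral_nonneg nonneg) simp

lemma population_objective_continuous:
  assumes "0 < e"
  shows "\<exists>r>0. \<forall>p. dist p q < r \<longrightarrow>
    \<bar>population_objective P (primitive h) Y q0 p - population_objective P (primitive h) Y q0 q\<bar> < e"
proof -
  let ?D = "dist q q0 + 1"
  let ?C = "b * (mean_rate + h ?D)"
  have C: "0 \<le> ?C"
    using b_ge_1 mean_rate_nonneg nonneg[of ?D] by simp
  obtain r where r: "0 < r" "r \<le> 1" "r * ?C < e"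
    using lipschitz_bound_small[OF assms C] .
  have "\<bar>population_objective P (primitive h) Y q0 p - population_objective P (primitive h) Y q0 q\<bar> < e"
    if p: "dist p q < r" for p
  proof -
    have "dist p q0 \<le> ?D" using dist_triangle[of p q0 q] p r(2) by simp
    then have "\<bar>population_objective P (primitive h) Y q0 p - population_objective P (primitive h) Y q0 q\<bar>
        \<le> dist p q * ?C"
      by (rule abs_population_diff_le) simp
    also have "\<dots> \<le> r * ?C" using p C by (intro mult_right_mono) simp_all
    finally show ?thesis using r(3) by simp
  qed
  with r(1) show ?thesis by blast
qed

text \<open>
  The Lipschitz constants of the empirical objectives on a ball grow with the average rate. When
  the averages converge, they are eventually below their limit plus one, which yields a common constant.
\<close>

lemma empirical_objective_equicontinuous:
  assumes rate: "(\<lambda>n. 1 / real n * (\<Sum>i=1..n. h (dist (y i) q0))) \<longlonglongrightarrow> mean_rate" and "0 < e"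
  shows "\<exists>r>0. \<forall>\<^sub>F n in sequentially. \<forall>p. dist p q < r \<longrightarrow>
    \<bar>empirical_objective (primitive h) y q0 n p - empirical_objective (primitive h) y q0 n q\<bar> < e"
proof -
  let ?D = "dist q q0 + 1"
  let ?C = "b * (mean_rate + 1 + h ?D)"
  have C: "0 \<le> ?C"
    using b_ge_1 mean_rate_nonneg nonneg[of ?D] by simp
  obtain r where r: "0 < r" "r \<le> 1" "r * ?C < e"
    using lipschitz_bound_small[OF assms(2) C] .
  have "\<forall>\<^sub>F n in sequentially. 1 / real n * (\<Sum>i=1..n. h (dist (y i) q0)) < mean_rate + 1"
    by (rule order_tendstoD(2)[OF rate]) simp
  then have "\<forall>\<^sub>F n in sequentially. \<forall>p. dist p q < r \<longrightarrow>
      \<bar>empirical_objective (primitive h) y q0 n p - empirical_objective (primitive h) y q0 n q\<bar> < e"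
    using eventually_ge_at_top[of 1]
  proof eventually_elim
    case (elim n)
    show ?case
    proof (intro allI impI)
      fix p assume p: "dist p q < r"
      have "dist p q0 \<le> ?D" using dist_triangle[of p q0 q] p r(2) by simp
      then have "\<bar>empirical_objective (primitive h) y q0 n p - empirical_objective (primitive h) y q0 n q\<bar>
          \<le> dist p q * (b * (1 / real n * (\<Sum>i=1..n. h (dist (y i) q0)) + h ?D))"
        by (rule abs_empirical_diff_le) (use elim in simp_all)
      also have "\<dots> \<le> dist p q * ?C"
        using elim(1) b_ge_1 by (intro mult_left_mono) simp_all
      also have "\<dots> \<le> r * ?C" using p C by (intro mult_right_mono) simp_all
      finally show "\<bar>empirical_objective (primitive h) y q0 n p - empirical_objective (primitive h) y q0 n q\<bar> < e"
        using r(3) by simp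
    qed
  qed
  with r(1) show ?thesis by blast
qed

end

section \<open>Consistency of approximate minimisers\<close>

theorem corollary4p3:
  fixes P :: "'w measure"
    and Y :: "'w \<Rightarrow> 'a::polish_space"
    and Ys :: "nat \<Rightarrow> 'w \<Rightarrow> 'a"
    and q0 :: 'a
    and h :: "real \<Rightarrow> real"
    and b :: real
    and \<epsilon> :: "nat \<Rightarrow> real"
  assumes "prob_space P"
    and "Y \<in> borel_measurable P"
    and "prob_space.indep_vars P (\<lambda>_. borel) Ys {1..}"
    and "\<And>i. i \<ge> 1 \<Longrightarrow> distr P borel (Ys i) = distr P borel Y"
    and "\<And>x. x \<ge> 0 \<Longrightarrow> h x \<ge> 0"
    and "mono_on {0..} h"
    and "\<And>n. n \<ge> 1 \<Longrightarrow> \<epsilon> n \<ge> 0"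
    and "\<epsilon> \<longlonglongrightarrow> 0"
    and "b \<ge> 1"
    and "\<And>x. x \<ge> 0 \<Longrightarrow> h (2 * x) \<le> b * h x"
    and "integrable P (\<lambda>\<omega>. h (dist (Y \<omega>) q0))"
  shows "AE \<omega> in P.
    outer_limit (\<lambda>n. eps_argmin_set (\<epsilon> n)
      (empirical_objective (primitive h) (\<lambda>i. Ys i \<omega>) q0 n))
    \<subseteq> argmin_set (population_objective P (primitive h) Y q0)"
proof -
  interpret prob_space P by fact
  interpret doubling_mean h b P Y q0
    by unfold_locales (use assms in \<open>auto simp: prob_space_axioms\<close>)
  let ?F = "population_objective P (primitive h) Y q0"
  let ?G = "\<lambda>\<omega>. empirical_objective (primitive h) (\<lambda>i. Ys i \<omega>) q0"
  obtain Q :: "'a set" where Q: "countable Q" "\<And>X. open X \<Longrightarrow> X \<noteq> {} \<Longrightarrow> \<exists>d\<in>Q. d \<in> X"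
    using countable_dense_setE by blast
  have dense: "closure Q = UNIV"
  proof -
    have "\<exists>d\<in>Q. dist d x < e" if "0 < e" for x e
      using Q(2)[of "ball x e"] that by (auto simp: dist_commute)
    then show ?thesis by (auto simp: closure_approachable)
  qed
  have rate: "AE \<omega> in P. (\<lambda>n. 1 / real n * (\<Sum>i=1..n. h (dist (Ys i \<omega>) q0))) \<longlonglongrightarrow> mean_rate"
    using strong_law_of_large_numbers_compose[OF assms(1-4) measurable_rate integrable_rate] .
  have "AE \<omega> in P. (\<lambda>n. ?G \<omega> n q) \<longlonglongrightarrow> ?F q" for q
    using strong_law_of_large_numbers_compose[OF assms(1-4) measurable_loss integrable_loss]
    unfolding empirical_objective_def population_objective_def .
  then have "AE \<omega> in P. \<forall>q\<in>Q. (\<lambda>n. ?G \<omega> n q) \<longlonglongrightarrow> ?F q"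
    using Q(1) by (simp add: AE_ball_countable)
  with rate show ?thesis
  proof eventually_elim
    case (elim \<omega>)
    show ?case
    proof (rule outer_limit_eps_argmin_subset[OF dense])
      show "(\<lambda>n. ?G \<omega> n q) \<longlonglongrightarrow> ?F q" if "q \<in> Q" for q
        using elim(2) that by blast
    qed (use elim(1) assms(8) in \<open>auto intro: empirical_objective_equicontinuous population_objective_continuous\<close>)
  qed
qed

end
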